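(* $\tau_{pp}$ is the unique topology $\tau$ on $I(\mathbb N)$ such that: $(I(\mathbb N),\tau)$ is a Polish topological inverse semigroup, the set of idempotents $\{1_A: A\subseteq\mathbb N\}$ is $\tau$-compact, and for every $A\subseteq\mathbb N$ the map $r_A:I(\mathbb N)\to R_A$, $r_A(f)=f\circ 1_A$, is open, where $R_A=\{f\circ 1_A: f\in I(\mathbb N)\}$ carries the subspace topology of $\tau$. That is, $\tau_{pp}$ has these properties, and any topology $\tau$ with these properties equals $\tau_{pp}$.
   Context: $I(\mathbb N)$ is the set of all bijections $f:B\to C$ with $B,C\subseteq\mathbb N$ (including the empty map), $\mathrm{dom}(f)=B$, $\mathrm{im}(f)=C$, with composition $\mathrm{dom}(f\circ g)=g^{-1}(\mathrm{dom}(f)\cap\mathrm{im}(g))$, $(f\circ g)(x)=f(g(x))$, and inversion $f\mapsto f^{-1}$. $1_A$ is the identity on $A$; these are the idempotents. For $x,y\in\mathbb N$: $v(x,y)=\{f: x\in\mathrm{dom}(f), f(x)=y\}$, $w_1(x)=\{f: x\notin\mathrm{dom}(f)\}$, $w_2(y)=\{f: y\notin\mathrm{im}(f)\}$; $\tau_{pp}$ is the topology generated by the subbasis of all these sets. A topological inverse semigroup has continuous multiplication and inversion. *)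

theory Defs
  imports "HOL-Analysis.Analysis"
begin

text \<open>Partial bijections on nat are represented as partial maps nat to nat option
  that are injective on their domain.\<close>

definition IN :: "(nat \<Rightarrow> nat option) set" where
  "IN = {f. inj_on f (dom f)}"

definition pcomp :: "(nat \<Rightarrow> nat option) \<Rightarrow> (nat \<Rightarrow> nat option) \<Rightarrow> (nat \<Rightarrow> nat option)" where
  "pcomp f g = f \<circ>\<^sub>m g"

definition pinv :: "(nat \<Rightarrow> nat option) \<Rightarrow> (nat \<Rightarrow> nat option)" where
  "pinv f = (\<lambda>y. if y \<in> ran f then Some (THE x. f x = Some y) else None)"

definition pid :: "nat set \<Rightarrow> (nat \<Rightarrow> nat option)" where
  "pid A = (\<lambda>x. if x \<in> A then Some x else None)"

definition v_set :: "nat \<Rightarrow> nat \<Rightarrow> (nat \<Rightarrow> nat option) set" where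
  "v_set x y = {f \<in> IN. f x = Some y}"

definition w1_set :: "nat \<Rightarrow> (nat \<Rightarrow> nat option) set" where
  "w1_set x = {f \<in> IN. x \<notin> dom f}"

definition w2_set :: "nat \<Rightarrow> (nat \<Rightarrow> nat option) set" where
  "w2_set y = {f \<in> IN. y \<notin> ran f}"

definition tau_pp :: "(nat \<Rightarrow> nat option) topology" where
  "tau_pp = topology_generated_by
     ({v_set x y | x y. True} \<union> {w1_set x | x. True} \<union> {w2_set y | y. True})"

definition Polish_space :: "'a topology \<Rightarrow> bool" where
  "Polish_space X \<longleftrightarrow> completely_metrizable_space X \<and> separable_space X"

definition topological_inverse_semigroup_IN :: "(nat \<Rightarrow> nat option) topology \<Rightarrow> bool" where
  "topological_inverse_semigroup_IN T \<longleftrightarrow>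
     topspace T = IN \<and>
     continuous_map (prod_topology T T) T (\<lambda>(f, g). pcomp f g) \<and>
     continuous_map T T pinv"

definition r_map :: "nat set \<Rightarrow> (nat \<Rightarrow> nat option) \<Rightarrow> (nat \<Rightarrow> nat option)" where
  "r_map A f = pcomp f (pid A)"

definition R_set :: "nat set \<Rightarrow> (nat \<Rightarrow> nat option) set" where
  "R_set A = r_map A ` IN"

definition good_topology :: "(nat \<Rightarrow> nat option) topology \<Rightarrow> bool" where
  "good_topology T \<longleftrightarrow>
     topspace T = IN \<and>
     Polish_space T \<and>
     topological_inverse_semigroup_IN T \<and>
     compactin T {pid A | A. True} \<and>
     (\<forall>A. open_map T (subtopology T (R_set A)) (r_map A))"

end

theory Submission
  imports Defs "HOL-Algebra.Group" "HOL-Real_Asymp.Real_Asymp"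
begin

text \<open>Let \<open>T\<close> be a topology as in the theorem. It refines \<open>tau_pp\<close>, because every subbasic set is the
  preimage of the complement of a point under a map built from composition, inversion and
  idempotents. On the group of permutations of the naturals both topologies are Polish group
  topologies, hence they agree there: by the Baire category theorem, every \<open>T\<close>-open set is contained
  in the interior of its \<open>tau_pp\<close>-closure, and by a lemma of Weston this forces the finer of two
  topologies to be the coarser one. Finally, every \<open>h\<close> in \<open>IN\<close> is a compression \<open>p \<sigma>(h) q\<close> of a
  permutation \<open>\<sigma>(h)\<close> that depends continuously on \<open>h\<close>, with fixed \<open>p\<close> and \<open>q\<close>. Thus the identity
  from \<open>tau_pp\<close> to \<open>T\<close> is continuous.\<close>

section \<open>Comparing Polish topologies\<close>

text \<open>Weston's lemma. A point \<open>y\<close> in the \<open>Y\<close>-closure of a small \<open>X\<close>-ball around \<open>x\<close> is \<open>X\<close>-close to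
  \<open>x\<close>: near openness yields \<open>X\<close>-Cauchy sequences starting at \<open>x\<close> and \<open>y\<close>, each term of the second lying
  in the \<open>Y\<close>-closure of a shrinking \<open>X\<close>-ball around the corresponding term of the first, and their
  limits coincide as \<open>Y\<close> is Hausdorff.\<close>

lemma nearly_open_finer_topology_eq:
  assumes cm: "completely_metrizable_space X" and haus: "Hausdorff_space Y"
    and top: "topspace X = topspace Y"
    and finer: "\<And>U. openin Y U \<Longrightarrow> openin X U"
    and near: "\<And>U. openin X U \<Longrightarrow> U \<subseteq> Y interior_of (Y closure_of U)"
  shows "X = Y"
proof -
  obtain M d where md: "Metric_space M d" "Metric_space.mcomplete M d" "X = Metric_space.mtopology M d"
    using cm unfolding completely_metrizable_space_def by blast
  interpret Metric_space M d by (rule md(1))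
  have X: "X = mtopology" by (rule md(3))
  have MY: "topspace Y = M" using top X by simp
  \<comment> \<open>The point \<open>b\<close> is interior to the \<open>Y\<close>-closure of its
    own ball, and this interior, a \<open>Y\<close>-neighbourhood of \<open>b\<close>, has to meet
    the ball around \<open>a\<close>.\<close>
  have near_ball: "\<exists>c. c \<in> mball a s \<and> c \<in> Y closure_of mball b t"
    if "b \<in> M" "b \<in> Y closure_of mball a s" "0 < t" for a b s t
  proof -
    have int: "b \<in> Y interior_of (Y closure_of mball b t)"
      using near[of "mball b t"] that X by auto
    have meets: "\<exists>c. c \<in> mball a s \<and> c \<in> W" if "b \<in> W" "openin Y W" for W
      using \<open>b \<in> Y closure_of mball a s\<close> that unfolding in_closure_of by simp
    show ?thesis
      using meets[OF int openin_interior_of] interior_of_subset[of Y "Y closure_of mball b t"] by auto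
  qed
  have dist_limit: "d (f 0) l \<le> 2 * r"
    if f: "\<And>n. f n \<in> M" and step: "\<And>n. d (f n) (f (Suc n)) < r / 2 ^ n"
      and lim: "limitin mtopology f l sequentially" for f l and r :: real
  proof -
    have bound: "d (f 0) (f n) \<le> 2 * r - 2 * r / 2 ^ n" for n
    proof (induction n)
      case 0
      show ?case using f by simp
    next
      case (Suc n)
      have "d (f 0) (f (Suc n)) \<le> d (f 0) (f n) + d (f n) (f (Suc n))"
        using f by (intro triangle)
      also have "\<dots> \<le> 2 * r - 2 * r / 2 ^ n + r / 2 ^ n"
        using Suc step[of n] by linarith
      also have "\<dots> = 2 * r - 2 * r / 2 ^ Suc n" by (simp add: field_simps)
      finally show ?case .
    qed
    have r: "0 < r"
      using le_less_trans[OF nonneg step[of 0]] by simp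
    show ?thesis
    proof (rule field_le_epsilon)
      fix e :: real assume "0 < e"
      then obtain n where n: "d (f n) l < e" and l: "l \<in> M"
        using lim unfolding limitin_metric eventually_sequentially by blast
      have "d (f 0) l \<le> d (f 0) (f n) + d (f n) l" using f l by (intro triangle)
      also have "\<dots> \<le> 2 * r + e"
        using bound[of n] n r zero_le_power[of "2::real" n] by (smt (verit) divide_nonneg_nonneg)
      finally show "d (f 0) l \<le> 2 * r + e" .
    qed
  qed
  have cauchy: "\<exists>l. limitin mtopology f l sequentially"
    if f: "\<And>n. f n \<in> M" and step: "\<And>n. d (f n) (f (Suc n)) < r / 2 ^ n" for f and r :: real
  proof -
    have r: "0 < r"
      using le_less_trans[OF nonneg step[of 0]] by simp
    have bound: "d (f n) (f (n + k)) \<le> 2 * r / 2 ^ n - 2 * r / 2 ^ (n + k)" for n k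
    proof (induction k)
      case 0
      show ?case using f by simp
    next
      case (Suc k)
      have "d (f n) (f (n + Suc k)) \<le> d (f n) (f (n + k)) + d (f (n + k)) (f (n + Suc k))"
        using f by (intro triangle)
      also have "\<dots> \<le> 2 * r / 2 ^ n - 2 * r / 2 ^ (n + k) + r / 2 ^ (n + k)"
        using Suc step[of "n + k"] by simp
      also have "\<dots> = 2 * r / 2 ^ n - 2 * r / 2 ^ (n + Suc k)" by (simp add: field_simps)
      finally show ?case .
    qed
    have bound': "d (f n) (f m) \<le> 2 * r / 2 ^ n" if "n \<le> m" for n m
      using bound[of n "m - n"] that r
      by (smt (verit) le_add_diff_inverse divide_nonneg_nonneg zero_le_power)
    have "MCauchy f"
      unfolding MCauchy_def
    proof (intro conjI allI impI)
      show "range f \<subseteq> M" using f by blast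
      fix e :: real assume e: "0 < e"
      obtain N where N: "(1/2::real) ^ N < e / (2 * r)"
        using real_arch_pow_inv[of "e / (2 * r)" "1/2"] e r by auto
      have le: "2 * r / 2 ^ n < e" if "N \<le> n" for n
      proof -
        have "(1/2::real) ^ n \<le> (1/2) ^ N" using that by (intro power_decreasing) auto
        with N have "(1/2::real) ^ n < e / (2 * r)" by linarith
        then have "2 * r * (1/2::real) ^ n < e" using r by (simp add: field_simps)
        then show ?thesis by (simp add: power_one_over field_simps)
      qed
      have *: "d (f n) (f m) < e" if "N \<le> n" "n \<le> m" for n m
        using bound'[OF that(2)] le[OF that(1)] by linarith
      show "\<exists>N. \<forall>n n'. N \<le> n \<longrightarrow> N \<le> n' \<longrightarrow> d (f n) (f n') < e"
        using * commute by (metis nat_le_linear)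
    qed
    then show ?thesis using md(2) unfolding mcomplete_def by blast
  qed
  have closure_ball: "d x y \<le> 4 * r"
    if x: "x \<in> M" and y: "y \<in> Y closure_of mball x r" and r: "0 < r" for x y r
  proof -
    \<comment> \<open>\<open>P\<close> is the invariant of a back-and-forth construction; its last
      clause pins the starting pair to \<open>(x, y)\<close>.\<close>
    define P where "P n p \<longleftrightarrow> fst p \<in> M \<and> snd p \<in> M \<and>
        snd p \<in> Y closure_of mball (fst p) (r / 2 ^ n) \<and> (n = 0 \<longrightarrow> p = (x, y))" for n :: nat and p
    define Q where "Q n p q \<longleftrightarrow> d (fst p) (fst q) < r / 2 ^ n \<and> d (snd p) (snd q) < r / 2 ^ n"
      for n :: nat and p q
    have yM: "y \<in> M" using y MY in_closure_of by metis
    have "\<exists>f. \<forall>n. P n (f n) \<and> Q n (f n) (f (Suc n))"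
    proof (rule dependent_nat_choice)
      show "\<exists>p. P 0 p" using x y yM unfolding P_def by auto
      fix p n assume p: "P n p"
      obtain a b where ab: "p = (a, b)" by force
      \<comment> \<open>\<open>near_ball\<close> is used twice with the roles exchanged: first
        \<open>a\<close> moves into the closure of a ball around \<open>b\<close>, then
        \<open>b\<close> moves into the closure of a ball of half the radius around
        \<open>a'\<close>.\<close>
      obtain a' where a': "a' \<in> mball a (r / 2 ^ n)" "a' \<in> Y closure_of mball b (r / 2 ^ n)"
        using near_ball[of b a "r / 2 ^ n" "r / 2 ^ n"] p r by (auto simp: P_def ab)
      obtain b' where b': "b' \<in> mball b (r / 2 ^ n)" "b' \<in> Y closure_of mball a' (r / 2 ^ Suc n)"
        using near_ball[of a' b "r / 2 ^ n" "r / 2 ^ Suc n"] a' r by auto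
      show "\<exists>q. P (Suc n) q \<and> Q n p q"
        using a' b' by (intro exI[of _ "(a', b')"]) (auto simp: P_def Q_def ab)
    qed
    then obtain f where f: "\<And>n. P n (f n)" "\<And>n. Q n (f n) (f (Suc n))" by blast
    define u v where "u n = fst (f n)" and "v n = snd (f n)" for n
    have u: "u n \<in> M" "d (u n) (u (Suc n)) < r / 2 ^ n" and v: "v n \<in> M" "d (v n) (v (Suc n)) < r / 2 ^ n"
      and vu: "v n \<in> Y closure_of mball (u n) (r / 2 ^ n)" for n
      using f[of n] f(1)[of "Suc n"] by (auto simp: P_def Q_def u_def v_def)
    have 0: "u 0 = x" "v 0 = y" using f(1)[of 0] by (auto simp: P_def u_def v_def)
    obtain a b where a: "limitin mtopology u a sequentially" and b: "limitin mtopology v b sequentially"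
      using cauchy[OF u] cauchy[OF v] by blast
    have abM: "a \<in> M" "b \<in> M" using a b limitin_mspace by auto
    \<comment> \<open>Otherwise disjoint \<open>Y\<close>-open sets separate the limits. A late ball
      around \<open>u n\<close> lies in one of them, and \<open>v n\<close>, being in the
      \<open>Y\<close>-closure of that ball, cannot lie in the other.\<close>
    have "a = b"
    proof (rule ccontr)
      assume "a \<noteq> b"
      then obtain A B where AB: "openin Y A" "openin Y B" "a \<in> A" "b \<in> B" "disjnt A B"
        using haus abM unfolding Hausdorff_space_def MY by blast
      obtain e where e: "0 < e" "mball a e \<subseteq> A"
        using finer[OF AB(1)] AB(3) unfolding X openin_mtopology by blast
      have "\<forall>\<^sub>F n in sequentially. d (u n) a < e / 2"
        using a e(1) unfolding limitin_metric by (auto elim!: allE[of _ "e / 2"] eventually_mono)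
      moreover have "\<forall>\<^sub>F n in sequentially. v n \<in> B"
        using b finer[OF AB(2)] AB(4) unfolding X limitin_def by blast
      moreover have "\<forall>\<^sub>F n in sequentially. r / 2 ^ n < e / 2"
        using e(1) by real_asymp
      ultimately have "\<forall>\<^sub>F n in sequentially. False"
      proof eventually_elim
        case (elim n)
        have "mball (u n) (r / 2 ^ n) \<subseteq> mball a e"
        proof
          fix z assume z: "z \<in> mball (u n) (r / 2 ^ n)"
          then have "d a z \<le> d (u n) a + d (u n) z"
            using triangle[of a "u n" z] abM u commute by auto
          also have "\<dots> < e / 2 + e / 2"
            using z elim(1) less_trans[OF _ elim(3)]
            by (intro add_strict_mono) (auto simp del: less_divide_eq_numeral1)
          finally have "d a z < e" by simp
          then show "z \<in> mball a e" using z abM(1) by simp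
        qed
        then have "mball (u n) (r / 2 ^ n) \<subseteq> A" using e(2) by (rule subset_trans)
        then have "v n \<in> Y closure_of A" by (rule subsetD[OF closure_of_mono vu])
        then have "\<forall>T. v n \<in> T \<and> openin Y T \<longrightarrow> (\<exists>z. z \<in> A \<and> z \<in> T)"
          by (simp add: in_closure_of)
        then obtain z where "z \<in> A" "z \<in> B"
          using elim(2) AB(2) by auto
        with AB(5) show False by (auto simp: disjnt_iff)
      qed
      then show False by simp
    qed
    moreover have "d x a \<le> 2 * r" "d y b \<le> 2 * r"
      using dist_limit[OF u a] dist_limit[OF v b] 0 by auto
    ultimately show "d x y \<le> 4 * r"
      using triangle[of x a y] commute[of a y] x yM abM by simp
  qed
  have "openin Y U" if U: "openin X U" for U
  proof (subst openin_subopen, intro ballI)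
    fix x assume x: "x \<in> U"
    then obtain s where s: "0 < s" "mball x s \<subseteq> U" and xM: "x \<in> M"
      using U openin_subset unfolding X openin_mtopology by blast
    \<comment> \<open>By \<open>closure_ball\<close>, the \<open>Y\<close>-closure of this ball
      stays within distance \<open>4 * s / 5 < s\<close> of \<open>x\<close>.\<close>
    let ?V = "Y interior_of (Y closure_of mball x (s / 5))"
    have "?V \<subseteq> mball x s"
    proof
      fix y assume "y \<in> ?V"
      then have y: "y \<in> Y closure_of mball x (s / 5)" by (rule subsetD[OF interior_of_subset])
      then have "y \<in> M" using MY by (simp add: in_closure_of)
      with closure_ball[OF xM y] s(1) xM show "y \<in> mball x s" by simp
    qed
    moreover have "x \<in> ?V" using near[of "mball x (s / 5)"] xM s(1) X by auto
    ultimately show "\<exists>T. openin Y T \<and> x \<in> T \<and> T \<subseteq> U"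
      using s(2) by (intro exI[of _ ?V] conjI openin_interior_of) simp_all
  qed
  with finer show ?thesis by (auto simp: topology_eq)
qed

section \<open>Comparable Polish topologies on a group\<close>

lemma metrizable_separable_imp_second_countable:
  assumes "metrizable_space X" "separable_space X"
  shows "second_countable X"
proof -
  obtain M d where md: "Metric_space M d" "X = Metric_space.mtopology M d"
    using assms(1) unfolding metrizable_space_def by blast
  interpret Metric_space M d by (rule md(1))
  obtain C where C: "countable C" "C \<subseteq> M" "mtopology closure_of C = M"
    using assms(2) unfolding separable_space_def md(2) by auto
  show ?thesis
    unfolding second_countable_def md(2)
  proof (intro exI conjI ballI allI impI)
    \<comment> \<open>Balls of radius \<open>1 / Suc n\<close> about the points of a countable dense
      set form a base.\<close>
    let ?B = "(\<lambda>(c, n). mball c (1 / real (Suc n))) ` (C \<times> UNIV)"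
    show "countable ?B" using C(1) by auto
    show "openin mtopology V" if "V \<in> ?B" for V using that by auto
    fix U x assume "openin mtopology U \<and> x \<in> U"
    then obtain r where r: "0 < r" "mball x r \<subseteq> U" and x: "x \<in> M"
      unfolding openin_mtopology by blast
    obtain n where n: "1 / real (Suc n) < r / 2"
      using nat_approx_posE[of "r / 2"] r(1) by auto
    have "x \<in> mball x (1 / real (Suc n))" using x by simp
    then obtain c where c: "c \<in> C" "c \<in> mball x (1 / real (Suc n))"
      using C(3) x openin_mball unfolding in_closure_of by (metis (no_types) C(3) in_closure_of)
    have "mball c (1 / real (Suc n)) \<subseteq> mball x r"
    proof
      fix z assume z: "z \<in> mball c (1 / real (Suc n))"
      then have "d x z \<le> d x c + d c z" using triangle x c by auto
      with z c n x show "z \<in> mball x r" by auto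
    qed
    then show "\<exists>V\<in>?B. x \<in> V \<and> V \<subseteq> U"
      using r(2) c commute[of c x] by (intro bexI[of _ "mball c (1 / real (Suc n))"]) auto
  qed
qed

text \<open>Near openness follows by a Baire argument. Countably many left translates of a small
  \<open>X\<close>-open set cover the group, so one of them has a \<open>Y\<close>-closure with
  nonempty interior, and a left translation carries this interior to a neighbourhood of the given
  point.\<close>

lemma (in group) finer_Polish_topology_eq:
  assumes top: "topspace X = carrier G" "topspace Y = carrier G"
    and finer: "\<And>U. openin Y U \<Longrightarrow> openin X U"
    and cmX: "completely_metrizable_space X" and lin: "Lindelof_space X"
    and cmY: "completely_metrizable_space Y"
    and multX: "continuous_map (prod_topology X X) X (\<lambda>(a, b). a \<otimes> b)"
    and invX: "continuous_map X X (\<lambda>a. inv a)"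
    and multY: "\<And>g. g \<in> carrier G \<Longrightarrow> continuous_map Y Y (\<lambda>a. g \<otimes> a)"
  shows "X = Y"
proof (rule nearly_open_finer_topology_eq[OF cmX _ _ finer])
  show "Hausdorff_space Y"
    using cmY completely_metrizable_imp_metrizable_space metrizable_imp_Hausdorff_space by blast
  show "topspace X = topspace Y" using top by simp
  have mult: "continuous_map Z X (\<lambda>z. f z \<otimes> h z)"
    if "continuous_map Z X f" "continuous_map Z X h" for f h and Z :: "'z topology"
    using continuous_map_compose[OF continuous_map_pairedI[OF that] multX] by (simp add: o_def)
  have multX1: "continuous_map X X (\<lambda>a. g \<otimes> a)" if "g \<in> carrier G" for g
    using that top by (intro mult) auto
  \<comment> \<open>Left translates are preimages under the inverse translation, so left
    translations are open maps in both topologies.\<close>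
  have preim: "{a \<in> carrier G. inv g \<otimes> a \<in> S} = (\<lambda>a. g \<otimes> a) ` S"
    if g: "g \<in> carrier G" and S: "S \<subseteq> carrier G" for g S
  proof (intro Set.set_eqI iffI)
    fix a assume "a \<in> {a \<in> carrier G. inv g \<otimes> a \<in> S}"
    then show "a \<in> (\<lambda>a. g \<otimes> a) ` S"
      using g by (intro image_eqI[of _ _ "inv g \<otimes> a"]) (auto simp: m_assoc[symmetric])
  next
    fix a assume "a \<in> (\<lambda>a. g \<otimes> a) ` S"
    then show "a \<in> {a \<in> carrier G. inv g \<otimes> a \<in> S}"
      using g S by (auto simp: m_assoc[symmetric] subset_iff)
  qed
  have openX: "openin X ((\<lambda>a. g \<otimes> a) ` S)" if "g \<in> carrier G" "openin X S" for g S
    using openin_continuous_map_preimage[OF multX1[of "inv g"] that(2)]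
      preim[OF that(1), of S] openin_subset[OF that(2)] that(1) top by simp
  have openY: "openin Y ((\<lambda>a. g \<otimes> a) ` S)" if "g \<in> carrier G" "openin Y S" for g S
    using openin_continuous_map_preimage[OF multY[of "inv g"] that(2)]
      preim[OF that(1), of S] openin_subset[OF that(2)] that(1) top by simp
  fix U assume U: "openin X U"
  show "U \<subseteq> Y interior_of (Y closure_of U)"
  proof
    fix x assume xU: "x \<in> U"
    then have x: "x \<in> carrier G" using U top openin_subset by blast
    \<comment> \<open>This map sends \<open>(x, x)\<close> to \<open>x\<close>, so continuity gives
      a neighbourhood \<open>V\<close> of \<open>x\<close> with
      \<open>x \<otimes> inv a \<otimes> b\<close> in \<open>U\<close> for all \<open>a\<close> and
      \<open>b\<close> in \<open>V\<close>.\<close>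
    let ?q = "\<lambda>p. x \<otimes> inv (fst p) \<otimes> snd p"
    have "continuous_map (prod_topology X X) X ?q"
      using x top
      by (intro mult continuous_map_snd continuous_map_compose[OF continuous_map_fst invX, unfolded o_def])
         simp_all
    from openin_continuous_map_preimage[OF this U]
    have "openin (prod_topology X X) {p \<in> topspace (prod_topology X X). ?q p \<in> U}" .
    note nbhds = this[unfolded openin_prod_topology_alt, rule_format]
    have "(x, x) \<in> {p \<in> topspace (prod_topology X X). ?q p \<in> U}"
      using x xU top by simp
    from nbhds[OF this] obtain V1 V2 where V12: "openin X V1" "openin X V2" "x \<in> V1" "x \<in> V2"
      and V12U: "V1 \<times> V2 \<subseteq> {p \<in> topspace (prod_topology X X). ?q p \<in> U}"
      by (elim exE conjE)
    define V where "V = V1 \<inter> V2"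
    have V: "openin X V" "x \<in> V" "V \<subseteq> carrier G"
      using V12 top openin_subset[OF V12(1)] unfolding V_def by auto
    have VU: "x \<otimes> inv a \<otimes> b \<in> U" if "a \<in> V" "b \<in> V" for a b
      using subsetD[OF V12U, of "(a, b)"] that unfolding V_def by simp
    let ?W = "\<lambda>g. (\<lambda>a. g \<otimes> a) ` V"
    have "\<Union>(?W ` carrier G) = topspace X"
    proof
      show "\<Union>(?W ` carrier G) \<subseteq> topspace X" using V top by auto
      show "topspace X \<subseteq> \<Union>(?W ` carrier G)"
      proof
        fix g assume "g \<in> topspace X"
        then have "g \<otimes> inv x \<in> carrier G" "g = (g \<otimes> inv x) \<otimes> x"
          using x top by (auto simp: m_assoc)
        then show "g \<in> \<Union>(?W ` carrier G)" using V(2) by blast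
      qed
    qed
    moreover have "openin X S" if "S \<in> ?W ` carrier G" for S
      using that openX[OF _ V(1)] by (elim imageE) simp
    ultimately obtain \<V> where "countable \<V>" "\<V> \<subseteq> ?W ` carrier G" "\<Union>\<V> = carrier G"
      using Lindelof_spaceD[OF lin, of "?W ` carrier G"] top(1) by metis
    then obtain C where C: "countable C" "C \<subseteq> carrier G" "\<Union>(?W ` C) = carrier G"
      by (metis countable_subset_image)
    \<comment> \<open>Otherwise, by the Baire category theorem in \<open>Y\<close>, the union of
      these closures would have empty interior, although it is the whole group.\<close>
    have "\<exists>g\<in>C. Y interior_of (Y closure_of ?W g) \<noteq> {}"
    proof (rule ccontr)
      assume "\<not> ?thesis"
      then have empty: "Y interior_of \<Union>((\<lambda>g. Y closure_of ?W g) ` C) = {}"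
        using cmY C(1) by (intro Baire_category_alt) auto
      have cover: "carrier G \<subseteq> \<Union>((\<lambda>g. Y closure_of ?W g) ` C)"
      proof -
        have "?W g \<subseteq> Y closure_of ?W g" if "g \<in> C" for g
          using that C(2) V(3) top by (intro closure_of_subset) auto
        then have "\<Union>(?W ` C) \<subseteq> \<Union>((\<lambda>g. Y closure_of ?W g) ` C)"
          by (intro UN_mono subset_refl)
        then show ?thesis unfolding C(3) .
      qed
      have "carrier G \<subseteq> Y interior_of \<Union>((\<lambda>g. Y closure_of ?W g) ` C)"
        using interior_of_maximal[OF cover] openin_topspace[of Y] top(2) by simp
      with empty x show False by auto
    qed
    then obtain g where g: "g \<in> carrier G" and ne: "Y interior_of (Y closure_of ?W g) \<noteq> {}"
      using C(2) by blast
    define O' where "O' = Y interior_of (Y closure_of ?W g)"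
    have O': "openin Y O'" "O' \<subseteq> Y closure_of ?W g" "O' \<noteq> {}"
      using ne unfolding O'_def by (simp_all add: interior_of_subset)
    then obtain w where "w \<in> O'" "w \<in> Y closure_of ?W g" by auto
    then obtain a where a: "a \<in> V" "g \<otimes> a \<in> O'"
      using O'(1) by (auto simp: in_closure_of)
    have aG: "a \<in> carrier G" using a V by blast
    \<comment> \<open>Translation by \<open>h\<close> takes the point \<open>g \<otimes> a\<close>
      of \<open>O'\<close> to \<open>x\<close>, and \<open>g \<otimes> b\<close> with
      \<open>b\<close> in \<open>V\<close> to \<open>x \<otimes> inv a \<otimes> b\<close>, which
      lies in \<open>U\<close>.\<close>
    define h where "h = x \<otimes> inv (g \<otimes> a)"
    have h: "h \<in> carrier G" using x g aG unfolding h_def by simp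
    have hW: "(\<lambda>b. h \<otimes> b) ` ?W g \<subseteq> U"
    proof (clarsimp)
      fix b assume b: "b \<in> V"
      then have bG: "b \<in> carrier G" using V(3) by (rule subsetD[rotated])
      have "inv g \<otimes> (g \<otimes> b) = b" using g bG by (simp add: m_assoc[symmetric])
      then have "h \<otimes> (g \<otimes> b) = x \<otimes> inv a \<otimes> b"
        using x g aG bG unfolding h_def by (simp add: inv_mult_group m_assoc)
      then show "h \<otimes> (g \<otimes> b) \<in> U" using VU[OF a(1) b] by simp
    qed
    have "(\<lambda>b. h \<otimes> b) ` O' \<subseteq> (\<lambda>b. h \<otimes> b) ` (Y closure_of ?W g)" using O'(2) by blast
    also have "\<dots> \<subseteq> Y closure_of ((\<lambda>b. h \<otimes> b) ` ?W g)"
      using continuous_map_image_closure_subset[OF multY[OF h]] .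
    also have "\<dots> \<subseteq> Y closure_of U" using hW by (rule closure_of_mono)
    finally have "(\<lambda>b. h \<otimes> b) ` O' \<subseteq> Y interior_of (Y closure_of U)"
      using openY[OF h O'(1)] by (intro interior_of_maximal)
    moreover have "h \<otimes> (g \<otimes> a) = x" using x g aG unfolding h_def by (simp add: m_assoc)
    ultimately show "x \<in> Y interior_of (Y closure_of U)" using a(2) by force
  qed
qed

section \<open>Partial bijections and the topology \<open>tau_pp\<close>\<close>

lemma IN_iff: "f \<in> IN \<longleftrightarrow> (\<forall>x y z. f x = Some z \<longrightarrow> f y = Some z \<longrightarrow> x = y)"
  unfolding IN_def inj_on_def by (auto, metis domI)

lemma IN_inj: "f \<in> IN \<Longrightarrow> f x = Some z \<Longrightarrow> f y = Some z \<Longrightarrow> x = y"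
  unfolding IN_iff by blast

lemma map_eqI: "(\<And>x y. f x = Some y \<longleftrightarrow> g x = Some y) \<Longrightarrow> f = g"
  by (metis ext not_Some_eq)

lemma pinv_eq_Some: "f \<in> IN \<Longrightarrow> pinv f y = Some x \<longleftrightarrow> f x = Some y"
  unfolding pinv_def ran_def by (auto intro: theI IN_inj the_equality)

lemma pinv_eq_None: "pinv f y = None \<longleftrightarrow> (\<forall>x. f x \<noteq> Some y)"
  unfolding pinv_def ran_def by auto

lemma pcomp_eq_Some: "pcomp f g x = Some z \<longleftrightarrow> (\<exists>y. g x = Some y \<and> f y = Some z)"
  unfolding pcomp_def by (auto simp: map_comp_Some_iff)

lemma pid_eq_Some: "pid A x = Some y \<longleftrightarrow> x \<in> A \<and> y = x"
  unfolding pid_def by auto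

lemma pcomp_IN: "f \<in> IN \<Longrightarrow> g \<in> IN \<Longrightarrow> pcomp f g \<in> IN"
  unfolding IN_iff pcomp_eq_Some by blast

lemma pid_IN: "pid A \<in> IN"
  unfolding IN_iff pid_eq_Some by blast

lemma pinv_IN: "f \<in> IN \<Longrightarrow> pinv f \<in> IN"
  unfolding IN_iff[of "pinv f"] by (simp add: pinv_eq_Some)

lemma pcomp_assoc: "pcomp (pcomp f g) h = pcomp f (pcomp g h)"
  by (rule map_eqI) (auto simp: pcomp_eq_Some)

lemma r_map_eq_Some: "r_map A f x = Some y \<longleftrightarrow> x \<in> A \<and> f x = Some y"
  unfolding r_map_def pcomp_eq_Some pid_eq_Some by auto

lemma R_set_eq: "R_set A = {h \<in> IN. dom h \<subseteq> A}"
proof (intro Set.set_eqI iffI)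
  fix h assume "h \<in> R_set A"
  then show "h \<in> {h \<in> IN. dom h \<subseteq> A}"
    unfolding R_set_def using r_map_eq_Some by (auto simp: r_map_def pcomp_IN pid_IN)
next
  fix h assume h: "h \<in> {h \<in> IN. dom h \<subseteq> A}"
  then have "r_map A h = h" by (intro map_eqI) (auto simp: r_map_eq_Some)
  with h show "h \<in> R_set A" unfolding R_set_def by force
qed

section \<open>Neighbourhoods in \<open>tau_pp\<close>\<close>

lemma topspace_tau_pp: "topspace tau_pp = IN"
  unfolding tau_pp_def topology_generated_by_topspace
proof (rule subset_antisym)
  let ?S = "{v_set x y |x y. True} \<union> {w1_set x |x. True} \<union> {w2_set y |y. True}"
  show "\<Union>?S \<subseteq> IN" by (auto simp: v_set_def w1_set_def w2_set_def)
  \<comment> \<open>Every \<open>f\<close> is either defined or undefined at the single point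
    \<open>0\<close>, so these subbasic sets already cover \<open>IN\<close>.\<close>
  have "f \<in> v_set 0 (the (f 0)) \<union> w1_set 0" if "f \<in> IN" for f
    using that by (auto simp: v_set_def w1_set_def)
  moreover have "v_set 0 y \<union> w1_set 0 \<subseteq> \<Union>?S" for y
    by (intro Un_least Union_upper) blast+
  ultimately show "IN \<subseteq> \<Union>?S" by (intro subsetI) (rule subsetD)
qed

lemma openin_tau_pp_subbasic:
  "openin tau_pp (v_set x y)" "openin tau_pp (w1_set x)" "openin tau_pp (w2_set y)"
  unfolding tau_pp_def by (intro topology_generated_by_Basis; blast)+

text \<open>Continuity is tested on the subbasis: the three conditions are openness of the preimages
  of \<open>v_set\<close>, \<open>w1_set\<close> and \<open>w2_set\<close>.\<close>

lemma continuous_map_into_tau_pp: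
  assumes "f \<in> topspace X \<rightarrow> IN"
    and "\<And>x y. openin X {a \<in> topspace X. f a x = Some y}"
    and "\<And>x. openin X {a \<in> topspace X. f a x = None}"
    and "\<And>y. openin X {a \<in> topspace X. \<forall>x. f a x \<noteq> Some y}"
  shows "continuous_map X tau_pp f"
  unfolding tau_pp_def
proof (rule continuous_on_generated_topo)
  have "f -` v_set x y \<inter> topspace X = {a \<in> topspace X. f a x = Some y}"
    "f -` w1_set x \<inter> topspace X = {a \<in> topspace X. f a x = None}"
    "f -` w2_set y \<inter> topspace X = {a \<in> topspace X. \<forall>x. f a x \<noteq> Some y}" for x y
    using assms(1) by (auto simp: v_set_def w1_set_def w2_set_def ran_def)
  then show "openin X (f -` U \<inter> topspace X)"
    if "U \<in> {v_set x y |x y. True} \<union> {w1_set x |x. True} \<union> {w2_set y |y. True}" for U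
    using that assms(2-4) by auto
  show "f ` topspace X \<subseteq> \<Union>({v_set x y |x y. True} \<union> {w1_set x |x. True} \<union> {w2_set y |y. True})"
    using assms(1) topspace_tau_pp unfolding tau_pp_def topology_generated_by_topspace by blast
qed

text \<open>\<open>F\<close> restricts arguments and values alike, because \<open>w2_set\<close>
  looks at the image. Comparing with \<open>Some y\<close> also records undefined points and missed
  values.\<close>

definition basic_nbhd :: "(nat \<Rightarrow> nat option) \<Rightarrow> nat set \<Rightarrow> (nat \<Rightarrow> nat option) set" where
  "basic_nbhd f F = {h \<in> IN. \<forall>x y. x \<in> F \<or> y \<in> F \<longrightarrow> (h x = Some y \<longleftrightarrow> f x = Some y)}"

lemma openin_basic_nbhd:
  assumes f: "f \<in> IN" and "finite F"
  shows "openin tau_pp (basic_nbhd f F)"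
  using \<open>finite F\<close>
proof (induction F)
  case empty
  have "basic_nbhd f {} = topspace tau_pp" unfolding basic_nbhd_def topspace_tau_pp by simp
  then show ?case by simp
next
  case (insert a F)
  have "openin tau_pp {h \<in> IN. \<forall>y. h a = Some y \<longleftrightarrow> f a = Some y}"
  proof (cases "f a")
    case None
    then have "{h \<in> IN. \<forall>y. h a = Some y \<longleftrightarrow> f a = Some y} = w1_set a"
      unfolding w1_set_def by auto
    then show ?thesis using openin_tau_pp_subbasic by simp
  next
    case (Some b)
    then have "{h \<in> IN. \<forall>y. h a = Some y \<longleftrightarrow> f a = Some y} = v_set a b"
      unfolding v_set_def by auto
    then show ?thesis using openin_tau_pp_subbasic by simp
  qed
  moreover have "openin tau_pp {h \<in> IN. \<forall>x. h x = Some a \<longleftrightarrow> f x = Some a}"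
  proof (cases "\<exists>b. f b = Some a")
    case False
    then have "{h \<in> IN. \<forall>x. h x = Some a \<longleftrightarrow> f x = Some a} = w2_set a"
      unfolding w2_set_def ran_def by auto
    then show ?thesis using openin_tau_pp_subbasic by simp
  next
    case True
    then obtain b where "f b = Some a" ..
    \<comment> \<open>By injectivity of \<open>h\<close> and \<open>f\<close>, the condition
      \<open>h b = Some a\<close> alone settles which points are sent to \<open>a\<close>.\<close>
    then have "{h \<in> IN. \<forall>x. h x = Some a \<longleftrightarrow> f x = Some a} = v_set b a"
      unfolding v_set_def using IN_inj[OF f] IN_inj by blast
    then show ?thesis using openin_tau_pp_subbasic by simp
  qed
  moreover have "basic_nbhd f (insert a F) = basic_nbhd f F \<inter>
      {h \<in> IN. \<forall>y. h a = Some y \<longleftrightarrow> f a = Some y} \<inter> {h \<in> IN. \<forall>x. h x = Some a \<longleftrightarrow> f x = Some a}"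
    unfolding basic_nbhd_def by auto
  ultimately show ?case using insert.IH by (simp add: openin_Int)
qed

lemma basic_nbhd_self: "f \<in> IN \<Longrightarrow> f \<in> basic_nbhd f F"
  unfolding basic_nbhd_def by simp

lemma basic_nbhd_Un: "basic_nbhd f (F \<union> F') = basic_nbhd f F \<inter> basic_nbhd f F'"
  unfolding basic_nbhd_def by auto

lemma tau_pp_basic_nbhd:
  assumes "openin tau_pp U" "f \<in> U"
  shows "\<exists>F. finite F \<and> basic_nbhd f F \<subseteq> U"
  using openin_topology_generated_by[OF assms(1)[unfolded tau_pp_def]] assms(2)
proof induction
  case Empty
  then show ?case by simp
next
  case (Int a b)
  then obtain F F' where "finite F" "basic_nbhd f F \<subseteq> a" "finite F'" "basic_nbhd f F' \<subseteq> b"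
    by auto
  then show ?case
    by (intro exI[of _ "F \<union> F'"]) (auto simp: basic_nbhd_Un)
next
  case (UN K)
  then show ?case by (meson Union_iff Union_upper subset_trans)
next
  case (Basis s)
  then consider x y where "s = v_set x y" | x where "s = w1_set x" | y where "s = w2_set y"
    by blast
  then show ?case
  proof cases
    case (1 x y)
    then have "basic_nbhd f {x} \<subseteq> s" using Basis(2) by (auto simp: v_set_def basic_nbhd_def)
    then show ?thesis by blast
  next
    case (2 x)
    then have "basic_nbhd f {x} \<subseteq> s" using Basis(2) by (auto simp: w1_set_def basic_nbhd_def)
    then show ?thesis by blast
  next
    case (3 y)
    then have "basic_nbhd f {y} \<subseteq> s" using Basis(2) by (auto simp: w2_set_def basic_nbhd_def ran_def)
    then show ?thesis by blast
  qed
qed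

lemma openin_tau_ppI:
  assumes "U \<subseteq> IN" "\<And>f. f \<in> U \<Longrightarrow> \<exists>F. finite F \<and> basic_nbhd f F \<subseteq> U"
  shows "openin tau_pp U"
  unfolding openin_subopen[of tau_pp U]
  using assms openin_basic_nbhd basic_nbhd_self by (meson subsetD)

section \<open>The required properties of \<open>tau_pp\<close>\<close>

lemma openin_tau_pp_coordinates:
  "openin tau_pp {f \<in> IN. f x = Some y}" "openin tau_pp {f \<in> IN. f x = None}"
  "openin tau_pp {f \<in> IN. \<forall>x. f x \<noteq> Some y}"
  using openin_tau_pp_subbasic(1)[of x y] openin_tau_pp_subbasic(2)[of x] openin_tau_pp_subbasic(3)[of y]
  by (simp_all add: v_set_def w1_set_def w2_set_def dom_def ran_def)

text \<open>Preimages split over the intermediate point \<open>z\<close>. The composition is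
  undefined at \<open>x\<close> if \<open>g\<close> is, or if \<open>f\<close> is undefined at the
  value of \<open>g\<close>; dually, it misses \<open>y\<close> if \<open>f\<close> does, or if
  \<open>g\<close> misses the point sent to \<open>y\<close> by \<open>f\<close>, which is unique by
  injectivity.\<close>

lemma continuous_map_pcomp_tau_pp:
  "continuous_map (prod_topology tau_pp tau_pp) tau_pp (\<lambda>(f, g). pcomp f g)"
proof (rule continuous_map_into_tau_pp)
  let ?P = "prod_topology tau_pp tau_pp"
  have top: "topspace ?P = IN \<times> IN" by (simp add: topspace_tau_pp)
  show "(\<lambda>(f, g). pcomp f g) \<in> topspace ?P \<rightarrow> IN"
    by (auto simp: topspace_tau_pp pcomp_IN)
  fix x y
  have "{a \<in> topspace ?P. (case a of (f, g) \<Rightarrow> pcomp f g) x = Some y} =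
      (\<Union>z. v_set z y \<times> v_set x z)"
    unfolding top by (auto simp: pcomp_eq_Some v_set_def)
  moreover have "openin ?P \<dots>"
    by (intro openin_Union) (auto simp: openin_prod_Times_iff openin_tau_pp_subbasic)
  ultimately show "openin ?P {a \<in> topspace ?P. (case a of (f, g) \<Rightarrow> pcomp f g) x = Some y}"
    by simp
  have "{a \<in> topspace ?P. (case a of (f, g) \<Rightarrow> pcomp f g) x = None} =
      (\<Union>z. w1_set z \<times> v_set x z) \<union> topspace tau_pp \<times> w1_set x"
    unfolding top topspace_tau_pp
    by (auto simp: pcomp_def map_comp_def v_set_def w1_set_def split: option.splits)
  moreover have "openin ?P \<dots>"
    by (intro openin_Un openin_Union) (auto simp: openin_prod_Times_iff openin_tau_pp_subbasic)
  ultimately show "openin ?P {a \<in> topspace ?P. (case a of (f, g) \<Rightarrow> pcomp f g) x = None}"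
    by simp
  have "{a \<in> topspace ?P. \<forall>x. (case a of (f, g) \<Rightarrow> pcomp f g) x \<noteq> Some y} =
      (\<Union>z. v_set z y \<times> w2_set z) \<union> w2_set y \<times> topspace tau_pp"
  proof (intro Set.set_eqI iffI)
    fix a assume a: "a \<in> {a \<in> topspace ?P. \<forall>x. (case a of (f, g) \<Rightarrow> pcomp f g) x \<noteq> Some y}"
    obtain f g where fg: "a = (f, g)" by force
    show "a \<in> (\<Union>z. v_set z y \<times> w2_set z) \<union> w2_set y \<times> topspace tau_pp"
      using a unfolding fg top topspace_tau_pp
      by (cases "\<exists>z. f z = Some y") (auto simp: pcomp_eq_Some v_set_def w2_set_def ran_def)
  next
    fix a assume "a \<in> (\<Union>z. v_set z y \<times> w2_set z) \<union> w2_set y \<times> topspace tau_pp"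
    then show "a \<in> {a \<in> topspace ?P. \<forall>x. (case a of (f, g) \<Rightarrow> pcomp f g) x \<noteq> Some y}"
      unfolding top topspace_tau_pp
      by (auto simp: pcomp_eq_Some v_set_def w2_set_def ran_def) (metis IN_inj)
  qed
  moreover have "openin ?P \<dots>"
    by (intro openin_Un openin_Union) (auto simp: openin_prod_Times_iff openin_tau_pp_subbasic)
  ultimately show "openin ?P {a \<in> topspace ?P. \<forall>x. (case a of (f, g) \<Rightarrow> pcomp f g) x \<noteq> Some y}"
    by simp
qed

text \<open>Inversion permutes the subbasis: it swaps the indices of \<open>v_set\<close> and
  exchanges \<open>w1_set\<close> with \<open>w2_set\<close>.\<close>

lemma continuous_map_pinv_tau_pp: "continuous_map tau_pp tau_pp pinv"
proof (rule continuous_map_into_tau_pp)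
  show "pinv \<in> topspace tau_pp \<rightarrow> IN" by (simp add: topspace_tau_pp pinv_IN)
  have "{a \<in> topspace tau_pp. pinv a x = Some y} = {f \<in> IN. f y = Some x}"
    "{a \<in> topspace tau_pp. pinv a x = None} = {f \<in> IN. \<forall>z. f z \<noteq> Some x}"
    "{a \<in> topspace tau_pp. \<forall>x. pinv a x \<noteq> Some y} = {f \<in> IN. f y = None}" for x y
    by (auto simp: topspace_tau_pp pinv_eq_Some pinv_eq_None)
  then show "openin tau_pp {a \<in> topspace tau_pp. pinv a x = Some y}"
    "openin tau_pp {a \<in> topspace tau_pp. pinv a x = None}"
    "openin tau_pp {a \<in> topspace tau_pp. \<forall>x. pinv a x \<noteq> Some y}" for x y
    using openin_tau_pp_coordinates by simp_all
qed

lemma topological_inverse_semigroup_tau_pp: "topological_inverse_semigroup_IN tau_pp"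
  unfolding topological_inverse_semigroup_IN_def
  using topspace_tau_pp continuous_map_pcomp_tau_pp continuous_map_pinv_tau_pp by blast

text \<open>The idempotents are a continuous image of the Cantor space of predicates on the
  naturals, which is compact by Tychonoff's theorem.\<close>

lemma compactin_idempotents_tau_pp: "compactin tau_pp {pid A | A. True}"
proof -
  let ?C = "product_topology (\<lambda>_::nat. discrete_topology (UNIV :: bool set)) UNIV"
  have "openin ?C {p. p x = b}" for x b
    using openin_continuous_map_preimage[OF continuous_map_product_projection
        [of x UNIV "\<lambda>_. discrete_topology (UNIV :: bool set)"], of "{b}"]
    by simp
  from this[of _ True] this[of _ False]
  have open_coord: "openin ?C {p. p x}" "openin ?C {p. \<not> p x}" for x by simp_all
  have "continuous_map ?C tau_pp (\<lambda>p. pid {x. p x})"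
  proof (rule continuous_map_into_tau_pp)
    show "(\<lambda>p. pid {x. p x}) \<in> topspace ?C \<rightarrow> IN" by (simp add: pid_IN)
    have "{p \<in> topspace ?C. pid {x. p x} x = Some y} = (if x = y then {p. p x} else {})"
      "{p \<in> topspace ?C. pid {x. p x} x = None} = {p. \<not> p x}"
      "{p \<in> topspace ?C. \<forall>x. pid {x. p x} x \<noteq> Some y} = {p. \<not> p y}" for x y
      by (auto simp: pid_def)
    then show "openin ?C {p \<in> topspace ?C. pid {x. p x} x = Some y}"
      "openin ?C {p \<in> topspace ?C. pid {x. p x} x = None}"
      "openin ?C {p \<in> topspace ?C. \<forall>x. pid {x. p x} x \<noteq> Some y}" for x y
      using open_coord by simp_all
  qed
  moreover have "compactin ?C (topspace ?C)"
    unfolding compact_space_def[symmetric]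
    by (simp add: compact_space_product_topology compact_space_discrete_topology)
  ultimately have "compactin tau_pp ((\<lambda>p. pid {x. p x}) ` topspace ?C)"
    by (rule image_compactin[rotated])
  moreover have "(\<lambda>p. pid {x. p x}) ` topspace ?C = {pid A | A. True}"
  proof -
    have "pid A \<in> (\<lambda>p. pid {x. p x}) ` UNIV" for A
      by (intro image_eqI[of _ _ "\<lambda>x. x \<in> A"]) auto
    then show ?thesis by auto
  qed
  ultimately show ?thesis by simp
qed

text \<open>Openness is a lifting property: a map with domain in \<open>A\<close> that is close to
  \<open>r_map A f\<close> has to extend to a map close to \<open>f\<close>. The extension copies
  \<open>f\<close> at finitely many points outside \<open>A\<close>.\<close>

lemma open_map_r_map_tau_pp: "open_map tau_pp (subtopology tau_pp (R_set A)) (r_map A)"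
  unfolding open_map_def
proof (intro allI impI)
  fix U assume U: "openin tau_pp U"
  show "openin (subtopology tau_pp (R_set A)) (r_map A ` U)"
    unfolding openin_subopen[of _ "r_map A ` U"]
  proof
    fix g assume "g \<in> r_map A ` U"
    then obtain f where f: "f \<in> U" and g: "g = r_map A f" by blast
    have fIN: "f \<in> IN" using U f openin_subset topspace_tau_pp by blast
    have gIN: "g \<in> IN" unfolding g r_map_def by (simp add: pcomp_IN pid_IN fIN)
    obtain F where F: "finite F" "basic_nbhd f F \<subseteq> U" using tau_pp_basic_nbhd[OF U f] by blast
    \<comment> \<open>These are the points outside \<open>A\<close> that have to be restored: those
      in \<open>F\<close> and those sent into \<open>F\<close>.\<close>
    define K where "K = {x. x \<notin> A \<and> (x \<in> F \<or> (\<exists>y\<in>F. f x = Some y))}"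
    \<comment> \<open>No value of \<open>f\<close> on \<open>K\<close> is a value of
      \<open>g\<close>, so including these values in \<open>F'\<close> keeps \<open>h\<close> from
      taking them and makes the extension injective. Where \<open>f\<close> is undefined,
      \<open>the (f x)\<close> is an unspecified number that at most shrinks the
      neighbourhood.\<close>
    define F' where "F' = F \<union> (\<lambda>x. the (f x)) ` K"
    have "finite {x. f x = Some y}" for y
    proof -
      have "{x. f x = Some y} \<subseteq> {THE x. f x = Some y}"
        using IN_inj[OF fIN] by (auto intro!: the_equality[symmetric])
      then show ?thesis by (rule finite_subset) simp
    qed
    then have "finite (F \<union> (\<Union>y\<in>F. {x. f x = Some y}))" using F(1) by simp
    moreover have "K \<subseteq> F \<union> (\<Union>y\<in>F. {x. f x = Some y})" unfolding K_def by auto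
    ultimately have "finite K" by (rule rev_finite_subset)
    then have F'fin: "finite F'" unfolding F'_def using F(1) by simp
    have "basic_nbhd g F' \<inter> R_set A \<subseteq> r_map A ` U"
    proof
      fix h assume h: "h \<in> basic_nbhd g F' \<inter> R_set A"
      then have hIN: "h \<in> IN" and hA: "\<And>x y. h x = Some y \<Longrightarrow> x \<in> A"
        by (auto simp: R_set_eq dom_def)
      have hN: "h x = Some y \<longleftrightarrow> x \<in> A \<and> f x = Some y" if "x \<in> F' \<or> y \<in> F'" for x y
        using h that by (auto simp: basic_nbhd_def g r_map_eq_Some)
      have FF': "F \<subseteq> F'" unfolding F'_def by blast
      have KF': "y \<in> F'" if "x \<in> K" "f x = Some y" for x y
        unfolding F'_def using that by force
      define h' where "h' x = (if x \<in> A then h x else if x \<in> K then f x else None)" for x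
      have h'S: "h' x = Some y \<longleftrightarrow> h x = Some y \<or> x \<in> K \<and> f x = Some y" for x y
        unfolding h'_def using hA by (auto simp: K_def)
      have "h' \<in> IN"
        unfolding IN_iff h'S using hN KF' IN_inj[OF hIN] IN_inj[OF fIN] by blast
      moreover have "h' x = Some y \<longleftrightarrow> f x = Some y" if "x \<in> F \<or> y \<in> F" for x y
        unfolding h'S using that hN[of x y] FF' by (auto simp: K_def)
      ultimately have "h' \<in> basic_nbhd f F" unfolding basic_nbhd_def by simp
      moreover have "r_map A h' = h"
        by (rule map_eqI) (use hA in \<open>auto simp: r_map_eq_Some h'S K_def\<close>)
      ultimately show "h \<in> r_map A ` U" using F(2) by blast
    qed
    moreover have "openin (subtopology tau_pp (R_set A)) (basic_nbhd g F' \<inter> R_set A)"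
      using openin_basic_nbhd[OF gIN F'fin] by (auto simp: openin_subtopology)
    moreover have "g \<in> basic_nbhd g F' \<inter> R_set A"
      using basic_nbhd_self[OF gIN] fIN unfolding R_set_def g by blast
    ultimately show "\<exists>T. openin (subtopology tau_pp (R_set A)) T \<and> g \<in> T \<and> T \<subseteq> r_map A ` U"
      by blast
  qed
qed

text \<open>Recording the values of both \<open>f\<close> and its inverse embeds \<open>IN\<close>
  as a closed set \<open>C\<close> in a countable power of a discrete space. The second half of the
  code turns \<open>w2_set\<close> into a condition on one coordinate.\<close>

lemma completely_metrizable_tau_pp: "completely_metrizable_space tau_pp"
proof -
  let ?P = "product_topology (\<lambda>_::nat + nat. discrete_topology (UNIV :: nat option set)) UNIV"
  define C :: "(nat + nat \<Rightarrow> nat option) set"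
    where "C = {p. \<forall>x y. p (Inl x) = Some y \<longleftrightarrow> p (Inr y) = Some x}"
  have coord: "openin ?P {p. p i \<in> S}" for i S
    using openin_continuous_map_preimage[OF continuous_map_product_projection
        [of i UNIV "\<lambda>_. discrete_topology (UNIV :: nat option set)"], of S]
    by simp
  have "openin ?P {p. (p (Inl x) = Some y) \<noteq> (p (Inr y) = Some x)}" for x y
  proof -
    have "{p. (p (Inl x) = Some y) \<noteq> (p (Inr y) = Some x)} =
        ({p. p (Inl x) \<in> {Some y}} \<inter> {p. p (Inr y) \<in> - {Some x}}) \<union>
        ({p. p (Inl x) \<in> - {Some y}} \<inter> {p. p (Inr y) \<in> {Some x}})" by auto
    then show ?thesis using coord by (simp only: openin_Un openin_Int)
  qed
  then have "openin ?P (\<Union>x. \<Union>y. {p. (p (Inl x) = Some y) \<noteq> (p (Inr y) = Some x)})"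
    by (intro openin_Union) auto
  moreover have "(\<Union>x. \<Union>y. {p. (p (Inl x) = Some y) \<noteq> (p (Inr y) = Some x)}) = topspace ?P - C"
    unfolding C_def by auto
  ultimately have "closedin ?P C"
    unfolding closedin_def by simp
  moreover have "completely_metrizable_space ?P"
    unfolding completely_metrizable_space_product_topology
    by (auto simp: completely_metrizable_space_discrete_topology)
  ultimately have cm: "completely_metrizable_space (subtopology ?P C)"
    by (intro completely_metrizable_space_closedin)
  define \<Phi> where "\<Phi> f = case_sum f (pinv f)" for f :: "nat \<Rightarrow> nat option"
  define \<Psi> where "\<Psi> p x = p (Inl x)" for p :: "nat + nat \<Rightarrow> nat option" and x
  have \<Phi>C: "\<Phi> f \<in> C" if "f \<in> IN" for f
    using that by (simp add: \<Phi>_def C_def pinv_eq_Some)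
  have \<Psi>IN: "\<Psi> p \<in> IN" if "p \<in> C" for p
    using that unfolding IN_iff \<Psi>_def C_def by auto
  have "continuous_map tau_pp ?P \<Phi>"
    unfolding continuous_map_componentwise_UNIV
  proof
    fix i
    have "openin tau_pp {f \<in> topspace tau_pp. \<Phi> f i = z}" for z
    proof (cases i)
      case (Inl x)
      then show ?thesis
        using openin_tau_pp_coordinates by (cases z) (simp_all add: \<Phi>_def topspace_tau_pp)
    next
      case (Inr y)
      have "{f \<in> topspace tau_pp. \<Phi> f i = Some x} = {f \<in> IN. f x = Some y}" for x
        using Inr by (auto simp: \<Phi>_def topspace_tau_pp pinv_eq_Some)
      moreover have "{f \<in> topspace tau_pp. \<Phi> f i = None} = {f \<in> IN. \<forall>x. f x \<noteq> Some y}"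
        using Inr by (auto simp: \<Phi>_def topspace_tau_pp pinv_eq_None)
      ultimately show ?thesis
        using openin_tau_pp_coordinates by (cases z) simp_all
    qed
    then have "openin tau_pp (\<Union>z\<in>S. {f \<in> topspace tau_pp. \<Phi> f i = z})" for S
      by (intro openin_Union) auto
    moreover have "(\<Union>z\<in>S. {f \<in> topspace tau_pp. \<Phi> f i = z}) = {f \<in> topspace tau_pp. \<Phi> f i \<in> S}" for S
      by auto
    ultimately show "continuous_map tau_pp (discrete_topology UNIV) (\<lambda>f. \<Phi> f i)"
      by (simp add: continuous_map_def)
  qed
  moreover have "continuous_map (subtopology ?P C) tau_pp \<Psi>"
  proof (rule continuous_map_into_tau_pp)
    have top: "topspace (subtopology ?P C) = C" by simp
    have sub: "openin (subtopology ?P C) {p \<in> C. p i = z}" for i z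
    proof -
      have "{p \<in> C. p i = z} = {p. p i \<in> {z}} \<inter> C" by auto
      with coord show ?thesis unfolding openin_subtopology by metis
    qed
    show "\<Psi> \<in> topspace (subtopology ?P C) \<rightarrow> IN" using \<Psi>IN by simp
    have "{p \<in> C. \<Psi> p x = Some y} = {p \<in> C. p (Inl x) = Some y}"
      "{p \<in> C. \<Psi> p x = None} = {p \<in> C. p (Inl x) = None}" for x y
      unfolding \<Psi>_def by auto
    then show "openin (subtopology ?P C) {p \<in> topspace (subtopology ?P C). \<Psi> p x = Some y}"
      "openin (subtopology ?P C) {p \<in> topspace (subtopology ?P C). \<Psi> p x = None}" for x y
      unfolding top using sub by simp_all
    have "{p \<in> C. \<forall>x. \<Psi> p x \<noteq> Some y} = {p \<in> C. p (Inr y) = None}" for y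
      unfolding \<Psi>_def C_def by (auto simp flip: not_Some_eq)
    then show "openin (subtopology ?P C) {p \<in> topspace (subtopology ?P C). \<forall>x. \<Psi> p x \<noteq> Some y}" for y
      unfolding top using sub by simp
  qed
  moreover have "\<Psi> (\<Phi> f) = f" for f
    unfolding \<Phi>_def \<Psi>_def by simp
  moreover have "\<Phi> (\<Psi> p) = p" if "p \<in> C" for p
  proof
    fix i show "\<Phi> (\<Psi> p) i = p i"
    proof (cases i)
      case (Inr y)
      have "pinv (\<Psi> p) = (\<lambda>y. p (Inr y))"
        by (rule map_eqI) (use that in \<open>simp add: pinv_eq_Some[OF \<Psi>IN] \<Psi>_def C_def\<close>)
      with Inr show ?thesis by (simp add: \<Phi>_def)
    qed (simp add: \<Phi>_def \<Psi>_def)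
  qed
  ultimately have "homeomorphic_maps tau_pp (subtopology ?P C) \<Phi> \<Psi>"
    unfolding homeomorphic_maps_def continuous_map_in_subtopology
    using \<Phi>C by (auto simp: topspace_tau_pp)
  then show ?thesis
    using cm homeomorphic_completely_metrizable_space unfolding homeomorphic_space_def by blast
qed

text \<open>Maps with finite domain are countable through their finite graphs. They are dense since
  a basic neighbourhood sees only finitely many pairs of the graph of \<open>f\<close>.\<close>

lemma separable_tau_pp: "separable_space tau_pp"
  unfolding separable_space_def
proof (intro exI conjI)
  let ?D = "{f \<in> IN. finite (dom f)}"
  have "inj_on Map.graph ?D"
  proof (rule inj_onI)
    fix f g :: "nat \<Rightarrow> nat option" assume "Map.graph f = Map.graph g"
    then show "f = g" by (intro map_eqI) (auto simp: Map.graph_def set_eq_iff)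
  qed
  moreover have "countable (Map.graph ` ?D)"
    by (rule countable_subset[OF _ countable_Collect_finite]) auto
  ultimately show "countable ?D" by (rule countable_image_inj_on[rotated])
  show "?D \<subseteq> topspace tau_pp" by (auto simp: topspace_tau_pp)
  show "tau_pp closure_of ?D = topspace tau_pp"
  proof (intro subset_antisym closure_of_subset_topspace subsetI)
    fix f assume "f \<in> topspace tau_pp"
    then have f: "f \<in> IN" by (simp add: topspace_tau_pp)
    have "\<exists>h. h \<in> ?D \<and> h \<in> U" if U: "openin tau_pp U" "f \<in> U" for U
    proof -
      obtain F where F: "finite F" "basic_nbhd f F \<subseteq> U" using tau_pp_basic_nbhd[OF U] by blast
      define h where "h x = (if x \<in> F \<or> (\<exists>y\<in>F. f x = Some y) then f x else None)" for x
      have hS: "h x = Some y \<longleftrightarrow> (x \<in> F \<or> y \<in> F) \<and> f x = Some y" for x y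
        unfolding h_def by auto
      have hIN: "h \<in> IN" unfolding IN_iff hS using IN_inj[OF f] by blast
      have "dom h \<subseteq> F \<union> (\<lambda>y. the (pinv f y)) ` F"
        using pinv_eq_Some[OF f] by (force simp: hS image_iff)
      then have "finite (dom h)" by (rule finite_subset) (simp add: F(1))
      moreover have "h \<in> basic_nbhd f F" unfolding basic_nbhd_def using hIN hS by blast
      ultimately show ?thesis using hIN F(2) by blast
    qed
    with f show "f \<in> tau_pp closure_of ?D" by (auto simp: in_closure_of topspace_tau_pp)
  qed
qed

lemma good_topology_tau_pp: "good_topology tau_pp"
  unfolding good_topology_def Polish_space_def
  using topspace_tau_pp completely_metrizable_tau_pp separable_tau_pp
    topological_inverse_semigroup_tau_pp compactin_idempotents_tau_pp open_map_r_map_tau_pp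
  by blast

section \<open>The group of permutations\<close>

text \<open>The symmetric group of the naturals is kept inside \<open>IN\<close>, so that
  \<open>T\<close> and \<open>tau_pp\<close> induce topologies on its carrier.\<close>

definition sym_group :: "(nat \<Rightarrow> nat option) monoid" where
  "sym_group = \<lparr>carrier = {f \<in> IN. dom f = UNIV \<and> ran f = UNIV}, mult = pcomp, one = pid UNIV\<rparr>"

lemma carrier_sym_group:
  "f \<in> carrier sym_group \<longleftrightarrow> f \<in> IN \<and> (\<forall>x. f x \<noteq> None) \<and> (\<forall>y. \<exists>x. f x = Some y)"
  by (auto simp: sym_group_def ran_def dom_def)

lemma mult_sym_group: "f \<otimes>\<^bsub>sym_group\<^esub> g = pcomp f g"
  by (simp add: sym_group_def)

lemma pinv_pcomp_sym_group: "f \<in> carrier sym_group \<Longrightarrow> pcomp (pinv f) f = pid UNIV"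
  by (rule map_eqI) (auto simp: carrier_sym_group pcomp_eq_Some pid_eq_Some pinv_eq_Some dest: IN_inj)

lemma pinv_sym_group: "f \<in> carrier sym_group \<Longrightarrow> pinv f \<in> carrier sym_group"
  unfolding carrier_sym_group by (auto simp: pinv_IN pinv_eq_Some pinv_eq_None)

lemma group_sym_group: "group sym_group"
proof (rule groupI)
  fix f g assume fg: "f \<in> carrier sym_group" "g \<in> carrier sym_group"
  have "pcomp f g \<in> carrier sym_group"
    unfolding carrier_sym_group
  proof (intro conjI allI)
    show "pcomp f g \<in> IN" using fg by (simp add: carrier_sym_group pcomp_IN)
    fix x
    obtain y z where "g x = Some y" "f y = Some z"
      using fg unfolding carrier_sym_group by blast
    then show "pcomp f g x \<noteq> None" by (metis option.distinct(1) pcomp_eq_Some)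
    obtain b where "f b = Some x" using fg unfolding carrier_sym_group by blast
    moreover obtain a where "g a = Some b" using fg unfolding carrier_sym_group by blast
    ultimately show "\<exists>a. pcomp f g a = Some x" unfolding pcomp_eq_Some by blast
  qed
  then show "f \<otimes>\<^bsub>sym_group\<^esub> g \<in> carrier sym_group" by (simp add: sym_group_def)
next
  have "pid UNIV \<in> carrier sym_group"
    unfolding carrier_sym_group by (intro conjI pid_IN) (auto simp: pid_def)
  then show "\<one>\<^bsub>sym_group\<^esub> \<in> carrier sym_group" by (simp add: sym_group_def)
next
  fix f assume f: "f \<in> carrier sym_group"
  show "\<one>\<^bsub>sym_group\<^esub> \<otimes>\<^bsub>sym_group\<^esub> f = f"
    by (rule map_eqI) (auto simp: sym_group_def pcomp_eq_Some pid_eq_Some)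
  show "\<exists>g\<in>carrier sym_group. g \<otimes>\<^bsub>sym_group\<^esub> f = \<one>\<^bsub>sym_group\<^esub>"
    using pinv_sym_group[OF f] pinv_pcomp_sym_group[OF f]
    by (intro bexI[of _ "pinv f"]) (simp_all add: sym_group_def)
qed (simp add: sym_group_def pcomp_assoc)

lemma inv_sym_group: "f \<in> carrier sym_group \<Longrightarrow> inv\<^bsub>sym_group\<^esub> f = pinv f"
  using pinv_sym_group pinv_pcomp_sym_group
  by (intro group.inv_equality[OF group_sym_group]) (simp_all add: sym_group_def)

text \<open>Failing to be a permutation means lying in some \<open>w1_set\<close> or
  \<open>w2_set\<close>. Closedness lets the group inherit complete metrizability.\<close>

lemma closedin_sym_group: "closedin tau_pp (carrier sym_group)"
proof -
  have "topspace tau_pp - carrier sym_group = (\<Union>x. w1_set x) \<union> (\<Union>y. w2_set y)"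
    by (auto simp: sym_group_def topspace_tau_pp w1_set_def w2_set_def)
  moreover have "openin tau_pp \<dots>"
    by (intro openin_Un openin_Union) (auto simp: openin_tau_pp_subbasic)
  moreover have "carrier sym_group \<subseteq> topspace tau_pp"
    by (auto simp: sym_group_def topspace_tau_pp)
  ultimately show ?thesis unfolding closedin_def by simp
qed

section \<open>Comparison of \<open>tau_pp\<close> with an arbitrary topology\<close>

lemma continuous_map_pcomp:
  assumes "topological_inverse_semigroup_IN T" "continuous_map X T f" "continuous_map X T g"
  shows "continuous_map X T (\<lambda>x. pcomp (f x) (g x))"
proof -
  have "continuous_map (prod_topology T T) T (\<lambda>(f, g). pcomp f g)"
    using assms(1) unfolding topological_inverse_semigroup_IN_def by blast
  from continuous_map_compose[OF continuous_map_pairedI[OF assms(2,3)] this]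
  show ?thesis by (simp add: o_def)
qed

lemma continuous_map_pinv:
  assumes "topological_inverse_semigroup_IN T" "continuous_map X T f"
  shows "continuous_map X T (\<lambda>x. pinv (f x))"
proof -
  have "continuous_map T T pinv"
    using assms(1) unfolding topological_inverse_semigroup_IN_def by blast
  from continuous_map_compose[OF assms(2) this] show ?thesis by (simp add: o_def)
qed

text \<open>Points are \<open>T\<close>-closed, so an inequation between a
  \<open>T\<close>-continuous expression in \<open>f\<close> and a constant is a
  \<open>T\<close>-open condition. Every subbasic condition has this form.\<close>

lemma tau_pp_coarsest:
  assumes T: "topological_inverse_semigroup_IN T" and t1: "t1_space T" and U: "openin tau_pp U"
  shows "openin T U"
proof -
  have top: "topspace T = IN" using T unfolding topological_inverse_semigroup_IN_def by blast
  have const: "continuous_map T T (\<lambda>_. pid A)" for A using pid_IN top by simp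
  have id: "continuous_map T T (\<lambda>f. f)" by simp
  have ne: "openin T {f \<in> topspace T. \<phi> f \<noteq> c}" if "continuous_map T T \<phi>" "c \<in> IN" for \<phi> c
  proof -
    have "openin T (topspace T - {c})"
      using t1 that(2) top by (intro openin_diff openin_topspace) (simp add: t1_space_closedin_singleton)
    from openin_continuous_map_preimage[OF that(1) this]
    have "openin T {f \<in> topspace T. \<phi> f \<in> topspace T - {c}}" .
    moreover have "{f \<in> topspace T. \<phi> f \<in> topspace T - {c}} = {f \<in> topspace T. \<phi> f \<noteq> c}"
      using continuous_map_image_subset_topspace[OF that(1)] by auto
    ultimately show ?thesis by simp
  qed
  \<comment> \<open>The map \<open>\<phi>\<close> is general so that the claim applies to
    \<open>f\<close> and to \<open>pinv f\<close>; the latter expresses that \<open>f\<close> misses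
    a value.\<close>
  have w1: "openin T {f \<in> topspace T. \<phi> f x = None}"
    if \<phi>: "continuous_map T T \<phi>" "\<And>f. f \<in> IN \<Longrightarrow> \<phi> f \<in> IN" for \<phi> x
  proof -
    have "pcomp (pinv g) (pcomp g (pid {x})) \<noteq> pid {x} \<longleftrightarrow> g x = None" if g: "g \<in> IN" for g
    proof (cases "g x")
      case None
      then have "pcomp (pinv g) (pcomp g (pid {x})) x \<noteq> Some x"
        by (simp add: pcomp_eq_Some pid_eq_Some)
      moreover have "pid {x} x = Some x" by (simp add: pid_def)
      ultimately show ?thesis using None by metis
    next
      case (Some y)
      then have "pcomp (pinv g) (pcomp g (pid {x})) = pid {x}"
        by (intro map_eqI) (use g in \<open>auto simp: pcomp_eq_Some pid_eq_Some pinv_eq_Some dest: IN_inj\<close>)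
      with Some show ?thesis by simp
    qed
    then have "{f \<in> topspace T. pcomp (pinv (\<phi> f)) (pcomp (\<phi> f) (pid {x})) \<noteq> pid {x}} =
        {f \<in> topspace T. \<phi> f x = None}"
      using \<phi>(2) top by auto
    moreover have "openin T {f \<in> topspace T. pcomp (pinv (\<phi> f)) (pcomp (\<phi> f) (pid {x})) \<noteq> pid {x}}"
      by (intro ne continuous_map_pcomp[OF T] continuous_map_pinv[OF T] const \<phi>(1) pid_IN)
    ultimately show ?thesis by simp
  qed
  have "continuous_map T tau_pp (\<lambda>f. f)"
  proof (rule continuous_map_into_tau_pp)
    show "(\<lambda>f. f) \<in> topspace T \<rightarrow> IN" using top by simp
    fix x y
    \<comment> \<open>Cutting \<open>f\<close> down to the argument \<open>x\<close> and the value
      \<open>y\<close> leaves one pair or the empty map \<open>pid {}\<close>.\<close>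
    have "pcomp (pid {y}) (pcomp f (pid {x})) \<noteq> pid {} \<longleftrightarrow> f x = Some y" for f
    proof
      assume "f x = Some y"
      then have "pcomp (pid {y}) (pcomp f (pid {x})) x = Some y"
        by (simp add: pcomp_eq_Some pid_eq_Some)
      then show "pcomp (pid {y}) (pcomp f (pid {x})) \<noteq> pid {}" by (auto simp: pid_def)
    next
      assume "pcomp (pid {y}) (pcomp f (pid {x})) \<noteq> pid {}"
      then have "\<exists>a b. pcomp (pid {y}) (pcomp f (pid {x})) a = Some b"
        using map_eqI[of "pcomp (pid {y}) (pcomp f (pid {x}))" "pid {}"] by (auto simp: pid_eq_Some)
      then obtain a b where "pcomp (pid {y}) (pcomp f (pid {x})) a = Some b" by blast
      then show "f x = Some y" by (auto simp: pcomp_eq_Some pid_eq_Some)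
    qed
    moreover have "openin T {f \<in> topspace T. pcomp (pid {y}) (pcomp f (pid {x})) \<noteq> pid {}}"
      by (intro ne continuous_map_pcomp[OF T] const id pid_IN)
    ultimately show "openin T {f \<in> topspace T. f x = Some y}" by simp
    show "openin T {f \<in> topspace T. f x = None}" using w1[OF id] by simp
    have "{f \<in> topspace T. pinv f y = None} = {f \<in> topspace T. \<forall>x. f x \<noteq> Some y}"
      by (simp add: pinv_eq_None)
    with w1[OF continuous_map_pinv[OF T id], of y]
    show "openin T {f \<in> topspace T. \<forall>x. f x \<noteq> Some y}" by (simp add: pinv_IN)
  qed
  from openin_continuous_map_preimage[OF this U]
  show ?thesis using openin_subset[OF U] top
    by (simp add: topspace_tau_pp Collect_conj_eq Int_absorb1)
qed

text \<open>The group is closed for \<open>tau_pp\<close>, hence for the finer \<open>T\<close>, so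
  both subspaces are completely metrizable and the comparison of Polish group topologies applies.
  Separability of \<open>T\<close> provides the Lindelof property.\<close>

lemma subtopology_sym_group_eq:
  assumes T: "topological_inverse_semigroup_IN T" and pol: "Polish_space T"
  shows "subtopology T (carrier sym_group) = subtopology tau_pp (carrier sym_group)"
proof (rule group.finer_Polish_topology_eq[OF group_sym_group])
  let ?S = "carrier sym_group"
  have top: "topspace T = IN" using T unfolding topological_inverse_semigroup_IN_def by blast
  have SIN: "?S \<subseteq> IN" by (auto simp: sym_group_def)
  have cm: "completely_metrizable_space T" and sep: "separable_space T"
    using pol unfolding Polish_space_def by auto
  have met: "metrizable_space T" using cm by (rule completely_metrizable_imp_metrizable_space)
  have t1: "t1_space T" using met by (simp add: metrizable_imp_Hausdorff_space Hausdorff_imp_t1_space)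
  note finer = tau_pp_coarsest[OF T t1]
  show "topspace (subtopology T ?S) = ?S" "topspace (subtopology tau_pp ?S) = ?S"
    using SIN top topspace_tau_pp by auto
  show "openin (subtopology T ?S) U" if "openin (subtopology tau_pp ?S) U" for U
    using that finer unfolding openin_subtopology by blast
  have "closedin T ?S"
    using closedin_sym_group finer unfolding closedin_def top topspace_tau_pp by blast
  then show "completely_metrizable_space (subtopology T ?S)"
    by (rule completely_metrizable_space_closedin[OF cm])
  show "completely_metrizable_space (subtopology tau_pp ?S)"
    by (rule completely_metrizable_space_closedin[OF completely_metrizable_tau_pp closedin_sym_group])
  show "Lindelof_space (subtopology T ?S)"
    by (intro second_countable_imp_Lindelof_space second_countable_subtopology
        metrizable_separable_imp_second_countable met sep)
  have closed: "f \<otimes>\<^bsub>sym_group\<^esub> g \<in> ?S" if "f \<in> ?S" "g \<in> ?S" for f g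
    using group.is_monoid[OF group_sym_group] that by (rule monoid.m_closed)
  have "continuous_map (prod_topology (subtopology T ?S) (subtopology T ?S)) T (\<lambda>p. pcomp (fst p) (snd p))"
    by (intro continuous_map_pcomp[OF T] continuous_map_into_fulltopology[OF continuous_map_fst]
        continuous_map_into_fulltopology[OF continuous_map_snd])
  then show "continuous_map (prod_topology (subtopology T ?S) (subtopology T ?S)) (subtopology T ?S)
      (\<lambda>(f, g). f \<otimes>\<^bsub>sym_group\<^esub> g)"
    using closed top SIN
    by (auto simp: continuous_map_in_subtopology case_prod_unfold mult_sym_group)
  have "continuous_map (subtopology T ?S) T pinv"
    using T unfolding topological_inverse_semigroup_IN_def
    by (intro continuous_map_from_subtopology) blast
  then have "continuous_map (subtopology T ?S) (subtopology T ?S) pinv"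
    using pinv_sym_group by (auto simp: continuous_map_in_subtopology)
  then show "continuous_map (subtopology T ?S) (subtopology T ?S) (\<lambda>a. inv\<^bsub>sym_group\<^esub> a)"
    by (rule continuous_map_eq) (simp add: inv_sym_group)
  fix g assume g: "g \<in> ?S"
  then have "continuous_map (subtopology tau_pp ?S) tau_pp (\<lambda>f. pcomp g f)"
    using SIN topspace_tau_pp
    by (intro continuous_map_pcomp[OF topological_inverse_semigroup_tau_pp] continuous_map_from_subtopology) auto
  then show "continuous_map (subtopology tau_pp ?S) (subtopology tau_pp ?S) (\<lambda>f. g \<otimes>\<^bsub>sym_group\<^esub> f)"
    using closed[OF g] by (auto simp: continuous_map_in_subtopology mult_sym_group)
qed

section \<open>Dilating partial bijections to permutations\<close>

text \<open>The analogue of Halmos's unitary dilation of a contraction, on two copies of the naturals (the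
  even and the odd numbers): in block form, the first row is \<open>h, 1 - h h'\<close> and the second row is
  \<open>1 - h' h, h'\<close>, where \<open>h'\<close> is the inverse of \<open>h\<close>.\<close>

definition dilation :: "(nat \<Rightarrow> nat option) \<Rightarrow> nat \<Rightarrow> nat option" where
  "dilation h n =
    (if even n then (case h (n div 2) of Some y \<Rightarrow> Some (2 * y) | None \<Rightarrow> Some (n + 1))
     else (case pinv h (n div 2) of Some x \<Rightarrow> Some (2 * x + 1) | None \<Rightarrow> Some (n - 1)))"

text \<open>The four cases are the four blocks, with the inverse of \<open>h\<close> expressed
  through \<open>h\<close>, so that bijectivity and compression can be read off.\<close>

lemma dilation_eq_Some:
  assumes h: "h \<in> IN"
  shows "dilation h n = Some m \<longleftrightarrow>
    (\<exists>x y. n = 2 * x \<and> m = 2 * y \<and> h x = Some y) \<or>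
    (\<exists>x. n = 2 * x \<and> m = 2 * x + 1 \<and> h x = None) \<or>
    (\<exists>x y. n = 2 * y + 1 \<and> m = 2 * x + 1 \<and> h x = Some y) \<or>
    (\<exists>y. n = 2 * y + 1 \<and> m = 2 * y \<and> (\<forall>x. h x \<noteq> Some y))"
proof (cases "even n")
  case True
  then obtain x where "n = 2 * x" by blast
  then show ?thesis
    by (cases "h x") (auto simp: dilation_def double_not_eq_Suc_double)
next
  case False
  then obtain y where n: "n = 2 * y + 1" by (rule oddE)
  show ?thesis
  proof (cases "pinv h y")
    case None
    then have "\<And>x. h x \<noteq> Some y" by (simp add: pinv_eq_None)
    with None show ?thesis
      using n by (auto simp: dilation_def Suc_double_not_eq_double)
  next
    case (Some x)
    then have "h x = Some y" "\<And>z. h z = Some y \<longleftrightarrow> z = x"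
      using pinv_eq_Some[OF h] IN_inj[OF h] by auto
    then show ?thesis
      using n Some by (auto simp: dilation_def Suc_double_not_eq_double)
  qed
qed

text \<open>The number \<open>2 * y\<close> is hit from \<open>2 * x\<close> if
  \<open>h x = Some y\<close>, and from \<open>2 * y + 1\<close> if \<open>h\<close> misses
  \<open>y\<close>. Likewise \<open>2 * x + 1\<close> is hit from \<open>2 * y + 1\<close> if
  \<open>h x = Some y\<close>, and from \<open>2 * x\<close> if \<open>h\<close> is undefined at
  \<open>x\<close>.\<close>

lemma dilation_in_sym_group:
  assumes h: "h \<in> IN"
  shows "dilation h \<in> carrier sym_group"
  unfolding carrier_sym_group
proof (intro conjI allI)
  have "m = n" if "dilation h m = Some k" "dilation h n = Some k" for m n k
    using that IN_inj[OF h] unfolding dilation_eq_Some[OF h]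
    by (elim disjE exE conjE)
      (auto simp: Suc_double_not_eq_double double_not_eq_Suc_double)
  then show "dilation h \<in> IN" unfolding IN_iff by blast
  show "dilation h n \<noteq> None" for n
    by (auto simp: dilation_def split: option.splits)
  fix m
  show "\<exists>n. dilation h n = Some m"
  proof (cases "even m")
    case True
    then obtain y where "m = 2 * y" by blast
    then show ?thesis
      unfolding dilation_eq_Some[OF h] by (cases "\<exists>x. h x = Some y") auto
  next
    case False
    then obtain x where "m = 2 * x + 1" by (rule oddE)
    then show ?thesis
      unfolding dilation_eq_Some[OF h] by (cases "h x") auto
  qed
qed

text \<open>The value at \<open>n\<close> depends only on the image and the preimage of
  \<open>n div 2\<close> under \<open>h\<close>, so a basic neighbourhood for one point fixes
  it.\<close>

lemma continuous_map_dilation: "continuous_map tau_pp (subtopology tau_pp (carrier sym_group)) dilation"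
proof -
  have same_value: "dilation h' n = dilation h n" if "h \<in> IN" "h' \<in> basic_nbhd h {n div 2}" for h h' n
  proof -
    have "h' \<in> IN" and eq: "\<And>x. h' (n div 2) = Some x \<longleftrightarrow> h (n div 2) = Some x"
      "\<And>x. h' x = Some (n div 2) \<longleftrightarrow> h x = Some (n div 2)"
      using that(2) unfolding basic_nbhd_def by auto
    then have "pinv h' (n div 2) = Some x \<longleftrightarrow> pinv h (n div 2) = Some x" for x
      using that(1) by (simp add: pinv_eq_Some)
    then have "pinv h' (n div 2) = pinv h (n div 2)" by (metis not_Some_eq)
    moreover have "h' (n div 2) = h (n div 2)" using eq(1) by (metis not_Some_eq)
    ultimately show ?thesis by (simp add: dilation_def)
  qed
  have mem: "dilation h \<in> IN" "dilation h n \<noteq> None" "\<exists>n. dilation h n = Some m" if "h \<in> IN" for h n m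
    using dilation_in_sym_group[OF that] by (simp_all add: carrier_sym_group)
  have "continuous_map tau_pp tau_pp dilation"
  proof (rule continuous_map_into_tau_pp)
    show "dilation \<in> topspace tau_pp \<rightarrow> IN" using mem by (simp add: topspace_tau_pp)
    fix n m
    show "openin tau_pp {h \<in> topspace tau_pp. dilation h n = Some m}"
    proof (rule openin_tau_ppI)
      fix h assume h: "h \<in> {h \<in> topspace tau_pp. dilation h n = Some m}"
      have "basic_nbhd h {n div 2} \<subseteq> {h \<in> topspace tau_pp. dilation h n = Some m}"
      proof
        fix h' assume h': "h' \<in> basic_nbhd h {n div 2}"
        then have "h' \<in> IN" unfolding basic_nbhd_def by simp
        with same_value[OF _ h'] h show "h' \<in> {h \<in> topspace tau_pp. dilation h n = Some m}"
          by (simp add: topspace_tau_pp)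
      qed
      then show "\<exists>F. finite F \<and> basic_nbhd h F \<subseteq> {h \<in> topspace tau_pp. dilation h n = Some m}"
        by (intro exI[of _ "{n div 2}"]) simp
    qed (auto simp: topspace_tau_pp)
    \<comment> \<open>Dilations are total and surjective, so the two remaining subbasic conditions
      define empty sets.\<close>
    have "{h \<in> topspace tau_pp. dilation h n = None} = {}"
      using mem(2) by (simp add: topspace_tau_pp)
    then show "openin tau_pp {h \<in> topspace tau_pp. dilation h n = None}"
      by (simp only: openin_empty)
    have "{h \<in> topspace tau_pp. \<forall>n. dilation h n \<noteq> Some m} = {}"
      using mem(3) by (simp add: topspace_tau_pp)
    then show "openin tau_pp {h \<in> topspace tau_pp. \<forall>n. dilation h n \<noteq> Some m}"
      by (simp only: openin_empty)
  qed
  then show ?thesis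
    using dilation_in_sym_group by (auto simp: continuous_map_in_subtopology topspace_tau_pp)
qed

text \<open>\<open>q\<close> identifies the naturals with the even numbers, so this compression cuts
  out the upper left block of the dilation.\<close>

lemma compress_dilation:
  assumes "h \<in> IN"
  defines "q \<equiv> \<lambda>x. Some (2 * x)"
  shows "q \<in> IN" "pcomp (pinv q) (pcomp (dilation h) q) = h"
proof -
  show q: "q \<in> IN" by (auto simp: IN_iff q_def)
  have qS: "q x = Some y \<longleftrightarrow> y = 2 * x" for x y by (auto simp: q_def)
  show "pcomp (pinv q) (pcomp (dilation h) q) = h"
    by (rule map_eqI) (auto simp: pcomp_eq_Some pinv_eq_Some[OF q] dilation_eq_Some[OF assms(1)] qS
        Suc_double_not_eq_double double_not_eq_Suc_double)
qed

text \<open>The identity factors as dilation followed by compression. Dilation is continuous into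
  the permutations, where both topologies agree, and compression is composition with constants,
  which is \<open>T\<close>-continuous.\<close>

lemma tau_pp_finest:
  assumes T: "topological_inverse_semigroup_IN T" and pol: "Polish_space T" and U: "openin T U"
  shows "openin tau_pp U"
proof -
  let ?S = "carrier sym_group"
  define q :: "nat \<Rightarrow> nat option" where "q = (\<lambda>x. Some (2 * x))"
  \<comment> \<open>\<open>compress_dilation\<close> yields \<open>q \<in> IN\<close> in the
    presence of some \<open>h\<close> in \<open>IN\<close>, which \<open>pid_IN\<close>
    supplies.\<close>
  have q: "q \<in> IN" "\<And>h. h \<in> IN \<Longrightarrow> pcomp (pinv q) (pcomp (dilation h) q) = h"
    using compress_dilation pid_IN unfolding q_def by blast+
  have top: "topspace T = IN" using T unfolding topological_inverse_semigroup_IN_def by blast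
  have "continuous_map tau_pp T dilation"
    using continuous_map_dilation unfolding subtopology_sym_group_eq[OF T pol, symmetric]
    by (rule continuous_map_into_fulltopology)
  then have "continuous_map tau_pp T (\<lambda>h. pcomp (pinv q) (pcomp (dilation h) q))"
    by (intro continuous_map_pcomp[OF T]) (simp_all add: q(1) pinv_IN top)
  then have "continuous_map tau_pp T (\<lambda>h. h)"
    by (rule continuous_map_eq) (simp add: q(2) topspace_tau_pp)
  from openin_continuous_map_preimage[OF this U]
  show ?thesis using openin_subset[OF U] top
    by (simp add: topspace_tau_pp Collect_conj_eq Int_absorb1)
qed

theorem theorem6p6:
  shows "good_topology tau_pp \<and> (\<forall>T. good_topology T \<longrightarrow> T = tau_pp)"
proof (intro conjI allI impI)
  show "good_topology tau_pp" by (rule good_topology_tau_pp)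
  fix T assume "good_topology T"
  then have T: "topological_inverse_semigroup_IN T" and pol: "Polish_space T"
    unfolding good_topology_def by blast+
  have "t1_space T"
    using pol unfolding Polish_space_def
    by (auto dest!: completely_metrizable_imp_metrizable_space metrizable_imp_Hausdorff_space
        Hausdorff_imp_t1_space)
  then show "T = tau_pp"
    unfolding topology_eq using tau_pp_coarsest[OF T] tau_pp_finest[OF T pol] by blast
qed

end
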